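(* Let $\mathcal{R}$ be an associative $\mathbb{C}$-algebra (commutative or not) and let $\mathfrak{N}\in\mathcal{R}$ satisfy $\mathfrak{N}^{m+1}=0$ for some integer $m\ge 0$. Then for every formal power series $F(z)=\sum_{k\ge 0} f_k z^k\in\mathbb{C}[[z]]$, $$F(\mathfrak{N})=\sum_{k=0}^{m} f_k\,\mathfrak{N}^k .$$ That is, the formally infinite series $F(\mathfrak{N})$ is, in $\mathcal{R}$, an exact finite sum of $m+1$ terms.
   Context: A nilpotent operational system (SON) is a tuple $(\mathcal{R},\mathfrak{N},m,M_{\mathcal{R}})$ where $\mathcal{R}$ is a $\mathbb{C}$-algebra (commutative or not), $\mathfrak{N}\in\mathcal{R}$ satisfies $\mathfrak{N}^{m+1}=0$ for some $m\ge 0$, and $M_{\mathcal{R}}(m)$ is the arithmetic cost of computing a product in $\mathcal{R}$ (this last datum plays no role in the claim). For $F(z)=\sum_{k\ge 0}f_kz^k\in\mathbb{C}[[z]]$, the evaluation is defined as the formal sum $F(\mathfrak{N}):=\sum_{k=0}^{\infty} f_k\,\mathfrak{N}^k$; no analytic convergence is required. *)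

theory Defs
  imports
    "HOL-Computational_Algebra.Formal_Power_Series"
    "HOL-Library.Groups_Big_Fun"
begin

text \<open>
  The sort \<open>{ring, monoid_mult}\<close> is used instead of \<open>ring_1\<close> because the latter requires
  \<open>0 \<noteq> 1\<close> and would exclude the zero algebra.
\<close>

locale complex_algebra = vector_space scale
  for scale :: "complex \<Rightarrow> 'a::{ring, monoid_mult} \<Rightarrow> 'a" +
  assumes scale_mult_left: "scale c x * y = scale c (x * y)"
    and scale_mult_right: "x * scale c y = scale c (x * y)"

text \<open>
  The series \<open>F(x) = f\<^sub>0 1 + f\<^sub>1 x + f\<^sub>2 x\<^sup>2 + \<dots>\<close> is read purely formally: an algebra carries no
  topology, so the sum denotes an element exactly when only finitely many of its terms are nonzero.
  \<^const>\<open>Sum_any\<close> returns \<open>0\<close> when infinitely many terms are nonzero; claims about \<open>fps_eval\<close>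
  should therefore come with \<open>fps_evaluable\<close>.
\<close>

definition fps_eval_term ::
    "(complex \<Rightarrow> 'a::{ring, monoid_mult} \<Rightarrow> 'a) \<Rightarrow> complex fps \<Rightarrow> 'a \<Rightarrow> nat \<Rightarrow> 'a" where
  "fps_eval_term scale F x k = scale (fps_nth F k) (x ^ k)"

definition fps_evaluable ::
    "(complex \<Rightarrow> 'a::{ring, monoid_mult} \<Rightarrow> 'a) \<Rightarrow> complex fps \<Rightarrow> 'a \<Rightarrow> bool" where
  "fps_evaluable scale F x \<longleftrightarrow> finite {k. fps_eval_term scale F x k \<noteq> 0}"

definition fps_eval ::
    "(complex \<Rightarrow> 'a::{ring, monoid_mult} \<Rightarrow> 'a) \<Rightarrow> complex fps \<Rightarrow> 'a \<Rightarrow> 'a" where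
  "fps_eval scale F x = Sum_any (fps_eval_term scale F x)"

end

theory Submission imports Defs begin

text \<open>
  Once one power of \<open>N\<close> vanishes, so does every later one, because it contains the vanishing power
  as a factor (\<open>power_eq_zero_above\<close>). The terms of degree above \<open>m\<close> are therefore scalar multiples
  of \<open>0\<close>, so the support of the series lies in the finite set \<open>{0..m}\<close>. This makes the formal sum
  meaningful and at the same time identifies it with the sum over \<open>{0..m}\<close>.
\<close>

lemma power_eq_zero_above:
  fixes x :: "'a::{ring, monoid_mult}"
  assumes "x ^ n = 0" and "n \<le> k"
  shows "x ^ k = 0"
proof -
  have "x ^ k = x ^ n * x ^ (k - n)"
    using assms(2) by (simp flip: power_add)
  then show ?thesis
    using assms(1) by simp
qed

theorem lemma1:
  fixes scale :: "complex \<Rightarrow> 'a::{ring, monoid_mult} \<Rightarrow> 'a"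
    and N :: 'a and m :: nat and F :: "complex fps"
  assumes "complex_algebra scale"
    and "N ^ (m + 1) = 0"
  shows "fps_evaluable scale F N \<and>
         fps_eval scale F N = (\<Sum>k=0..m. scale (fps_nth F k) (N ^ k))"
proof -
  interpret complex_algebra scale
    by (fact assms(1))
  have "fps_eval_term scale F N k = 0" if "m < k" for k
    using power_eq_zero_above[OF assms(2), of k] that by (simp add: fps_eval_term_def)
  then have support: "{k. fps_eval_term scale F N k \<noteq> 0} \<subseteq> {0..m}"
    by (auto simp flip: not_less)
  then have "fps_evaluable scale F N"
    unfolding fps_evaluable_def by (rule finite_subset) simp
  moreover have "fps_eval scale F N = (\<Sum>k=0..m. fps_eval_term scale F N k)"
    unfolding fps_eval_def using support by (intro Sum_any.expand_superset) simp_all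
  ultimately show ?thesis
    by (simp add: fps_eval_term_def)
qed

end
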